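(* Let $\sigma,\pi\in\mathbb{CK}$ be such that $\pi\prec\sigma$ and $|\sigma|-|\pi|>4$. Then there is some $\tau\in\mathbb{CK}$ such that $\pi\prec\tau\prec\sigma$ and $|\sigma|-|\tau|\le 4$.
   Context: $S_n$ is the set of permutations of $\{1,\dots,n\}$, written in one-line notation $\sigma=[\sigma_1,\dots,\sigma_n]$; for $\sigma\in S_n$, $|\sigma|=n$ denotes its order (length). For $n\ge 2$, $CK_n$ is the set of cylindrical king permutations of order $n$: those $\sigma\in S_n$ with $|\sigma_{i+1}-\sigma_i|>1$ for all $1\le i\le n-1$ and $|\sigma_1-\sigma_n|>1$. By convention $CK_1=S_1$. Put $\mathbb{CK}=\bigcup_{n\ge 1}CK_n$. For $\sigma\in S_n$, $\pi\in S_k$ with $k<n$, write $\pi\prec\sigma$ if the one-line notation of $\sigma$ has a (not necessarily consecutive) subsequence order-isomorphic to $\pi$. *)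

theory Defs
  imports "HOL-Combinatorics.Multiset_Permutations" "HOL-Library.Sublist"
begin

text \<open>
  A permutation in \<open>S\<^sub>n\<close> is its one-line notation, a list of natural numbers; its order is the
  list length. List positions are zero-based, so \<open>\<sigma>\<^sub>i\<close> is \<open>\<sigma> ! (i - 1)\<close>.
\<close>

definition perms :: "nat \<Rightarrow> nat list set" where
  "perms n = permutations_of_set {1..n}"

text \<open>The value at \<open>n = 0\<close> is irrelevant: the union \<open>CK_all\<close> starts at \<open>n = 1\<close>.\<close>

definition CK :: "nat \<Rightarrow> nat list set" where
  "CK n = (if n = 1 then perms 1
           else {\<sigma> \<in> perms n. (\<forall>i. i + 1 < n \<longrightarrow> \<bar>int (\<sigma> ! (i + 1)) - int (\<sigma> ! i)\<bar> > 1)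
                         \<and> \<bar>int (\<sigma> ! 0) - int (\<sigma> ! (n - 1))\<bar> > 1})"

definition CK_all :: "nat list set" where
  "CK_all = (\<Union>n\<in>{1..}. CK n)"

definition order_isomorphic :: "nat list \<Rightarrow> nat list \<Rightarrow> bool" where
  "order_isomorphic xs ys \<longleftrightarrow> length xs = length ys \<and>
     (\<forall>i < length xs. \<forall>j < length xs. xs ! i < xs ! j \<longleftrightarrow> ys ! i < ys ! j)"

text \<open>Containment is strict, being defined only between permutations of different orders.\<close>

definition pattern_less :: "nat list \<Rightarrow> nat list \<Rightarrow> bool"  (infix "\<prec>" 50) where
  "\<pi> \<prec> \<sigma> \<longleftrightarrow> length \<pi> < length \<sigma> \<and> (\<exists>\<rho>. subseq \<rho> \<sigma> \<and> order_isomorphic \<rho> \<pi>)"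

end

theory Submission
  imports Defs
begin

text \<open>
  Let \<open>U\<close> be the set of points of \<open>\<sigma>\<close> and \<open>P\<close> the subset forming an occurrence of \<open>\<pi>\<close>. It is enough to
  find a cylindrical king set strictly between \<open>P\<close> and \<open>U\<close> whenever at least five points are missing,
  since this can be repeated with the new set in place of \<open>P\<close>.

  Suppose adding one point \<open>y\<close> to \<open>P\<close> never gives a king set. Then each \<open>y\<close> outside \<open>P\<close> is adjacent, in
  position and in value, to exactly one point of \<open>P\<close> (two centres would be adjacent in \<open>P\<close>); so
  the points of \<open>U - P\<close> form clusters around points of \<open>P\<close>. If points of two clusters interleave in
  position or in value, each of them separates the other from its centre, and adding these two gives
  a king set. If no clusters interleave, every cluster with its centre is an interval of \<open>U\<close>,
  and adding one whole cluster to \<open>P\<close> gives a king set. This set is smaller than \<open>U\<close> unless there is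
  only one cluster; \<open>cluster_cyc_king\<close> and \<open>intermediate\<close> contain this argument.

  With a single cluster the question is local: the cluster with its centre \<open>p\<close> is a linear king
  permutation with at least six points, and it has to contain a smaller nontrivial one through \<open>p\<close>. A
  permutation without 2413 and 3142 is separable and hence has a pair adjacent in position
  and value, so a king permutation contains one of these patterns, which can be
  adjusted or extended by one point to include \<open>p\<close> (\<open>king_small_through_point\<close>). Its size
  is at most five.

  If \<open>P\<close> is a single point, any other point serves as well, and \<open>P\<close> is first replaced by a
  cylindrical king set of size five: the same pattern 2413 or 3142, together with the point of smallest value
  (\<open>cyc_king_has_five\<close>).
\<close>

section \<open>King sets of points\<close>

definition between :: "('a \<Rightarrow> int) \<Rightarrow> 'a \<Rightarrow> 'a \<Rightarrow> 'a \<Rightarrow> bool" where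
  "between f x z y \<longleftrightarrow> (f x < f z \<and> f z < f y) \<or> (f y < f z \<and> f z < f x)"

text \<open>
  The cyclic order of the positions: \<open>z\<close> lies strictly inside the arc that runs upwards from \<open>x\<close> to
  \<open>y\<close>, wrapping around after the largest position.
\<close>

definition arc :: "('a \<Rightarrow> int) \<Rightarrow> 'a \<Rightarrow> 'a \<Rightarrow> 'a \<Rightarrow> bool" where
  "arc f x z y \<longleftrightarrow> (f x < f z \<and> f z < f y) \<or> (f z < f y \<and> f y < f x) \<or> (f y < f x \<and> f x < f z)"

definition lin_adj :: "('a \<Rightarrow> int) \<Rightarrow> 'a set \<Rightarrow> 'a \<Rightarrow> 'a \<Rightarrow> bool" where
  "lin_adj f S x y \<longleftrightarrow> (\<forall>z\<in>S. \<not> between f x z y)"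

definition cyc_adj :: "('a \<Rightarrow> int) \<Rightarrow> 'a set \<Rightarrow> 'a \<Rightarrow> 'a \<Rightarrow> bool" where
  "cyc_adj f S x y \<longleftrightarrow> (\<forall>z\<in>S. \<not> arc f x z y) \<or> (\<forall>z\<in>S. \<not> arc f y z x)"

text \<open>
  A permutation is treated as a set of points carrying an injective position \<open>f\<close> and an injective
  value \<open>g\<close>, so that a pattern is a subset and needs no renumbering: two points are
  adjacent in a subset when no third point of that subset separates them. Such a subset is a king
  permutation when no pair is adjacent both in position and in value.
\<close>

definition king :: "('a \<Rightarrow> int) \<Rightarrow> ('a \<Rightarrow> int) \<Rightarrow> 'a set \<Rightarrow> bool" where
  "king f g S \<longleftrightarrow> (\<forall>x\<in>S. \<forall>y\<in>S. x \<noteq> y \<longrightarrow> \<not> (lin_adj f S x y \<and> lin_adj g S x y))"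

definition cyc_king :: "('a \<Rightarrow> int) \<Rightarrow> ('a \<Rightarrow> int) \<Rightarrow> 'a set \<Rightarrow> bool" where
  "cyc_king f g S \<longleftrightarrow> (\<forall>x\<in>S. \<forall>y\<in>S. x \<noteq> y \<longrightarrow> \<not> (cyc_adj f S x y \<and> lin_adj g S x y))"

section \<open>Separable permutations\<close>

text \<open>
  The patterns 2413 and 3142, the only simple permutations of length four. Negating the values
  exchanges them.
\<close>

definition crossing :: "('a \<Rightarrow> int) \<Rightarrow> ('a \<Rightarrow> int) \<Rightarrow> 'a \<Rightarrow> 'a \<Rightarrow> 'a \<Rightarrow> 'a \<Rightarrow> bool" where
  "crossing f g a b c d \<longleftrightarrow> f a < f b \<and> f b < f c \<and> f c < f d \<and>
     ((g c < g a \<and> g a < g d \<and> g d < g b) \<or> (g b < g d \<and> g d < g a \<and> g a < g c))"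

text \<open>
  A direct sum decomposition; a skew sum is \<open>splits\<close> with negated values.
\<close>

definition splits :: "('a \<Rightarrow> int) \<Rightarrow> ('a \<Rightarrow> int) \<Rightarrow> 'a set \<Rightarrow> 'a set \<Rightarrow> bool" where
  "splits f g A B \<longleftrightarrow> A \<noteq> {} \<and> B \<noteq> {} \<and> (\<forall>a\<in>A. \<forall>b\<in>B. f a < f b \<and> g a < g b)"

lemma between_commute: "between f x z y \<longleftrightarrow> between f y z x"
  by (auto simp: between_def)

lemma crossing_uminus [simp]: "crossing f (\<lambda>x. - g x) a b c d \<longleftrightarrow> crossing f g a b c d"
  by (auto simp: crossing_def)

text \<open>
  If \<open>x\<close> is above all of \<open>A\<close>, it joins \<open>B\<close>; if it is below everything, it splits off on its own.
  Otherwise the value of \<open>x\<close> divides \<open>A\<close> into a lower part \<open>L\<close> and a higher part \<open>H\<close>. A point of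
  \<open>H\<close> to the left of a point of \<open>L\<close> would form 3142 together with any point of \<open>B\<close> and
  with \<open>x\<close>, so all of \<open>L\<close> comes first and can be cut off.
\<close>

lemma splits_insert_last:
  assumes AB: "splits f g A B" and S: "S = A \<union> B"
    and injf: "inj_on f (insert x S)" and inj: "inj_on g (insert x S)" and last: "\<forall>y\<in>S. f y < f x"
    and no: "\<not> (\<exists>a\<in>insert x S. \<exists>b\<in>insert x S. \<exists>c\<in>insert x S. \<exists>d\<in>insert x S. crossing f g a b c d)"
  shows "\<exists>C D. insert x S = C \<union> D \<and> (splits f g C D \<or> splits f (\<lambda>x. - g x) C D)"
proof -
  have xS: "x \<notin> S" using last by auto
  have ne: "g y \<noteq> g x" if "y \<in> S" for y
    using inj that xS by (auto simp: inj_on_def)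
  have lt: "f a < f b" "g a < g b" if "a \<in> A" "b \<in> B" for a b
    using AB that by (auto simp: splits_def)
  show ?thesis
  proof (cases "\<forall>a\<in>A. g a < g x")
    case True
    then have "splits f g A (insert x B)"
      using AB S last by (auto simp: splits_def)
    then show ?thesis using S by (intro exI[of _ A] exI[of _ "insert x B"]) auto
  next
    case False
    then obtain h where h: "h \<in> A" "g x < g h" using ne S by (metis UnCI linorder_neqE)
    define L where "L = {a\<in>A. g a < g x}"
    define H where "H = {a\<in>A. g x < g a}"
    have A: "A = L \<union> H" using ne S by (force simp: L_def H_def)
    show ?thesis
    proof (cases "L = {}")
      case True
      have "g x < g y" if "y \<in> S" for y
      proof -
        have A_up: "g x < g a" if "a \<in> A" for a
          using that True ne[of a] S unfolding L_def by force
        show ?thesis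
        proof (cases "y \<in> A")
          case True
          then show ?thesis by (rule A_up)
        next
          case False
          then have "g h < g y" using that S h(1) lt(2) by auto
          then show ?thesis using h(2) by simp
        qed
      qed
      then have "splits f (\<lambda>x. - g x) S {x}"
        using AB S last by (auto simp: splits_def)
      then show ?thesis by (intro exI[of _ S] exI[of _ "{x}"]) auto
    next
      case False
      obtain b where b: "b \<in> B" using AB by (auto simp: splits_def)
      have LH: "f l < f k" if "l \<in> L" "k \<in> H" for l k
      proof (rule ccontr)
        assume "\<not> f l < f k"
        moreover have "f k \<noteq> f l"
        proof -
          have "k \<noteq> l" "k \<in> S" "l \<in> S" using that S by (auto simp: L_def H_def)
          then show ?thesis using injf by (auto simp: inj_on_def)
        qed
        ultimately have "crossing f g k l b x"
          using that lt[of l b] lt[of k b] b last S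
          by (auto simp: crossing_def L_def H_def)
        then show False using no that b S by (auto simp: L_def H_def)
      qed
      \<comment> \<open>the value of \<open>x\<close> lies above \<open>L\<close> and below \<open>H\<close> and \<open>B\<close>\<close>
      have "splits f g L (insert x (H \<union> B))"
        unfolding splits_def
      proof (intro conjI ballI)
        fix l y assume l: "l \<in> L" and "y \<in> insert x (H \<union> B)"
        then consider "y = x" | "y \<in> H" | "y \<in> B" by auto
        then show "f l < f y" "g l < g y"
          by (cases; use l LH last S lt in \<open>force simp: L_def H_def\<close>)+
      qed (use False in auto)
      then show ?thesis using S A by (intro exI[of _ L] exI[of _ "insert x (H \<union> B)"]) auto
    qed
  qed
qed

text \<open>
  Permutations without 2413 and 3142 are separable.
\<close>

lemma no_crossing_splits:
  assumes "finite S" "2 \<le> card S" "inj_on f S" "inj_on g S"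
    and "\<not> (\<exists>a\<in>S. \<exists>b\<in>S. \<exists>c\<in>S. \<exists>d\<in>S. crossing f g a b c d)"
  shows "\<exists>A B. S = A \<union> B \<and> (splits f g A B \<or> splits f (\<lambda>x. - g x) A B)"
  using assms
proof (induction S rule: finite_ranking_induct[where f = f])
  case empty
  then show ?case by simp
next
  case (insert x S)
  show ?case
  proof (cases "x \<in> S")
    case True
    then show ?thesis using insert by (simp add: insert_absorb)
  next
    case False
    have last: "\<forall>y\<in>S. f y < f x"
    proof
      fix y assume "y \<in> S"
      then have "f y \<le> f x" "f y \<noteq> f x"
        using insert.hyps(2) insert.prems(2) False by (auto simp: inj_on_def)
      then show "f y < f x" by simp
    qed
    show ?thesis
    proof (cases "card S \<ge> 2")
      case True
      then obtain A B where S: "S = A \<union> B"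
        and AB: "splits f g A B \<or> splits f (\<lambda>x. - g x) A B"
        using insert.IH insert.prems by (auto simp: inj_on_def)
      from AB show ?thesis
      proof
        assume "splits f g A B"
        then show ?thesis using splits_insert_last[OF _ S insert.prems(2,3) last insert.prems(4)] by blast
      next
        assume AB': "splits f (\<lambda>x. - g x) A B"
        have "inj_on (\<lambda>x. - g x) (insert x S)"
          using insert.prems(3) by (auto simp: inj_on_def)
        then show ?thesis
          using splits_insert_last[OF AB' S insert.prems(2) _ last] insert.prems(4) by auto
      qed
    next
      case c: False
      then have "card S = 1"
        using insert.prems(1) insert.hyps(1) False by simp
      then obtain y where S: "S = {y}" by (auto simp: card_1_singleton_iff)
      then have "f y < f x" "g y \<noteq> g x" using last insert.prems(3) False by (auto simp: inj_on_def)
      then have "splits f g {y} {x} \<or> splits f (\<lambda>x. - g x) {y} {x}"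
        by (auto simp: splits_def)
      then show ?thesis using S by (intro exI[of _ "{y}"] exI[of _ "{x}"]) auto
    qed
  qed
qed

lemma king_uminus [simp]: "king f (\<lambda>x. - g x) S \<longleftrightarrow> king f g S"
proof -
  have "between (\<lambda>x. - g x) x z y \<longleftrightarrow> between g x z y" for x z y
    by (auto simp: between_def)
  then have "lin_adj (\<lambda>x. - g x) S x y \<longleftrightarrow> lin_adj g S x y" for x y
    by (simp add: lin_adj_def)
  then show ?thesis by (simp add: king_def)
qed

text \<open>
  Both parts of a direct sum are intervals in position and in value, so no point of one part
  separates two points of the other.
\<close>

lemma splits_king_parts:
  assumes "king f g (A \<union> B)" "splits f g A B"
  shows "king f g A" "king f g B"
proof -
  have lt: "f a < f b" "g a < g b" if "a \<in> A" "b \<in> B" for a b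
    using assms(2) that by (auto simp: splits_def)
  have A: "lin_adj h (A \<union> B) x y" if "lin_adj h A x y" "x \<in> A" "y \<in> A" "h \<in> {f, g}" for h x y
  proof -
    have "h x < h z \<and> h y < h z" if "z \<in> B" for z
      using that \<open>x \<in> A\<close> \<open>y \<in> A\<close> \<open>h \<in> {f, g}\<close> lt by auto
    then have "\<not> between h x z y" if "z \<in> B" for z using that by (fastforce simp: between_def)
    then show ?thesis using that by (auto simp: lin_adj_def)
  qed
  have B: "lin_adj h (A \<union> B) x y" if "lin_adj h B x y" "x \<in> B" "y \<in> B" "h \<in> {f, g}" for h x y
  proof -
    have "h z < h x \<and> h z < h y" if "z \<in> A" for z
      using that \<open>x \<in> B\<close> \<open>y \<in> B\<close> \<open>h \<in> {f, g}\<close> lt by auto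
    then have "\<not> between h x z y" if "z \<in> A" for z using that by (fastforce simp: between_def)
    then show ?thesis using that by (auto simp: lin_adj_def)
  qed
  show "king f g A" unfolding king_def
  proof (intro ballI impI notI)
    fix x y assume "x \<in> A" "y \<in> A" "x \<noteq> y" "lin_adj f A x y \<and> lin_adj g A x y"
    then show False using assms(1) A[of f x y] A[of g x y] by (auto simp: king_def)
  qed
  show "king f g B" unfolding king_def
  proof (intro ballI impI notI)
    fix x y assume "x \<in> B" "y \<in> B" "x \<noteq> y" "lin_adj f B x y \<and> lin_adj g B x y"
    then show False using assms(1) B[of f x y] B[of g x y] by (auto simp: king_def)
  qed
qed

text \<open>
  A separable permutation with at least two points has an adjacent pair: decompose it
  repeatedly until both parts are single points.
\<close>

lemma king_has_crossing:
  assumes "finite S" "2 \<le> card S" "inj_on f S" "inj_on g S" "king f g S"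
  shows "\<exists>a\<in>S. \<exists>b\<in>S. \<exists>c\<in>S. \<exists>d\<in>S. crossing f g a b c d"
  using assms
proof (induction "card S" arbitrary: S rule: less_induct)
  case less
  show ?case
  proof (rule ccontr)
    assume no: "\<not> ?thesis"
    then obtain A B where S: "S = A \<union> B"
      and AB: "splits f g A B \<or> splits f (\<lambda>x. - g x) A B"
      using no_crossing_splits less.prems by metis
    have parts: "king f g A" "king f g B"
      using AB splits_king_parts[of f g A B] splits_king_parts[of f "\<lambda>x. - g x" A B] less.prems S by auto
    have ne: "A \<noteq> {}" "B \<noteq> {}" "A \<inter> B = {}" using AB by (fastforce simp: splits_def)+
    have fin: "finite A" "finite B" using less.prems S by auto
    have card: "card S = card A + card B" using S ne fin by (simp add: card_Un_disjoint)
    have pos: "card A > 0" "card B > 0" using ne fin by (auto simp: card_gt_0_iff)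
    have inj: "inj_on f A" "inj_on g A" "inj_on f B" "inj_on g B"
      using less.prems S by (auto intro: inj_on_subset)
    have "\<not> 2 \<le> card A"
      using less.hyps[of A] card pos fin parts inj no S by auto
    moreover have "\<not> 2 \<le> card B"
      using less.hyps[of B] card pos fin parts inj no S by auto
    ultimately have "card A = 1" "card B = 1" using pos by auto
    then obtain a b where ab: "A = {a}" "B = {b}" by (auto simp: card_1_singleton_iff)
    then have "\<not> king f g S"
      using S ne by (auto simp: king_def lin_adj_def between_def)
    then show False using less.prems by simp
  qed
qed

lemma crossing_king:
  assumes "crossing f g a b c d"
  shows "king f g {a, b, c, d}"
proof -
  have "between g a d b" "between f a b c" "between f a b d"
    "between g b a c" "between f b c d" "between g c a d"
    using assms by (auto simp: crossing_def between_def)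
  moreover from this have "between g b d a" "between f c b a" "between f d b a"
    "between g c a b" "between f d c b" "between g d a c"
    by (simp_all add: between_commute)
  ultimately show ?thesis unfolding king_def lin_adj_def by blast
qed

lemma lin_adj_same_side:
  assumes "lin_adj f S p q" "inj_on f (insert p (insert q S))" "z \<in> S" "z \<noteq> p" "z \<noteq> q"
  shows "f p < f z \<longleftrightarrow> f q < f z" "f z < f p \<longleftrightarrow> f z < f q"
proof -
  have "f z \<noteq> f p" "f z \<noteq> f q" "\<not> between f p z q"
    using assms by (auto simp: inj_on_def lin_adj_def)
  then show "f p < f z \<longleftrightarrow> f q < f z" "f z < f p \<longleftrightarrow> f z < f q"
    unfolding between_def by linarith+
qed

lemma crossing_replace:
  assumes cr: "crossing f g a b c d" and q: "q \<in> {a, b, c, d}" and p: "p \<notin> {a, b, c, d}"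
    and inj: "inj_on f {a, b, c, d, p}" "inj_on g {a, b, c, d, p}"
    and adj: "lin_adj f {a, b, c, d, p} p q" "lin_adj g {a, b, c, d, p} p q"
  shows "\<exists>a' b' c' d'. {a', b', c', d'} \<subseteq> {a, b, c, d, p} \<and> p \<in> {a', b', c', d'} \<and> crossing f g a' b' c' d'"
proof -
  have eq: "insert p (insert q {a, b, c, d, p}) = {a, b, c, d, p}" using q by auto
  have ne: "a \<noteq> b" "a \<noteq> c" "a \<noteq> d" "b \<noteq> c" "b \<noteq> d" "c \<noteq> d"
    using cr by (auto simp: crossing_def)
  have side: "(f p < f z \<longleftrightarrow> f q < f z) \<and> (f z < f p \<longleftrightarrow> f z < f q)
      \<and> (g p < g z \<longleftrightarrow> g q < g z) \<and> (g z < g p \<longleftrightarrow> g z < g q)"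
    if "z \<in> {a, b, c, d}" "z \<noteq> q" for z
    using lin_adj_same_side[OF adj(1)] lin_adj_same_side[OF adj(2)] inj that p eq by auto
  consider "q = a" | "q = b" | "q = c" | "q = d" using q by auto
  then show ?thesis
  proof cases
    case 1
    then have "crossing f g p b c d" using cr side[of b] side[of c] side[of d] ne by (simp add: crossing_def)
    then show ?thesis by (intro exI[of _ p] exI[of _ b] exI[of _ c] exI[of _ d]) simp
  next
    case 2
    then have "crossing f g a p c d" using cr side[of a] side[of c] side[of d] ne by (simp add: crossing_def)
    then show ?thesis by (intro exI[of _ a] exI[of _ p] exI[of _ c] exI[of _ d]) simp
  next
    case 3
    then have "crossing f g a b p d" using cr side[of a] side[of b] side[of d] ne by (simp add: crossing_def)
    then show ?thesis by (intro exI[of _ a] exI[of _ b] exI[of _ p] exI[of _ d]) simp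
  next
    case 4
    then have "crossing f g a b c p" using cr side[of a] side[of b] side[of c] ne by (simp add: crossing_def)
    then show ?thesis by (intro exI[of _ a] exI[of _ b] exI[of _ c] exI[of _ p]) simp
  qed
qed

text \<open>
  Take any 2413 or 3142. Either adding \<open>p\<close> to it gives a king set of size five, or
  \<open>p\<close> is adjacent to one of the four points in position and in value and can take its place.
\<close>

lemma king_small_through_point:
  assumes S: "finite S" "2 \<le> card S" "inj_on f S" "inj_on g S" "king f g S" and p: "p \<in> S"
  shows "\<exists>K\<subseteq>S. p \<in> K \<and> card K \<in> {4, 5} \<and> king f g K"
proof -
  obtain a b c d where Q: "{a, b, c, d} \<subseteq> S" and cr: "crossing f g a b c d"
    using king_has_crossing[OF S] by blast
  have card4: "card {a, b, c, d} = 4" if "crossing f g a b c d" for a b c d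
    using that by (auto simp: crossing_def card_insert_if)
  show ?thesis
  proof (cases "p \<in> {a, b, c, d}")
    case True
    then show ?thesis using Q cr card4[OF cr] crossing_king[OF cr] by blast
  next
    case p': False
    let ?K = "{a, b, c, d, p}"
    have K: "?K = insert p {a, b, c, d}" by auto
    have sub: "?K \<subseteq> S" using Q p by auto
    have inj: "inj_on f ?K" "inj_on g ?K" using inj_on_subset[OF _ sub] S by blast+
    show ?thesis
    proof (cases "king f g ?K")
      case True
      moreover have "card ?K = 5" unfolding K using p' card4[OF cr] by simp
      ultimately show ?thesis using sub by (intro exI[of _ ?K]) auto
    next
      case False
      then obtain x y where xy: "x \<in> ?K" "y \<in> ?K" "x \<noteq> y" "lin_adj f ?K x y" "lin_adj g ?K x y"
        by (auto simp: king_def)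
      have sym: "lin_adj h ?K u v \<Longrightarrow> lin_adj h ?K v u" for h u v
        by (auto simp: lin_adj_def between_def)
      have "x = p \<or> y = p"
      proof (rule ccontr)
        assume "\<not> ?thesis"
        moreover have "lin_adj f {a, b, c, d} x y" "lin_adj g {a, b, c, d} x y"
          using xy(4,5) by (auto simp: lin_adj_def)
        ultimately show False using crossing_king[OF cr] xy(1-3) unfolding king_def by blast
      qed
      then obtain q where "q \<in> {a, b, c, d}" "lin_adj f ?K p q" "lin_adj g ?K p q"
        using xy sym by (metis K insertE)
      from crossing_replace[OF cr this(1) p' inj this(2,3)]
      show ?thesis using sub card4 crossing_king by (metis insertI1 subset_trans)
    qed
  qed
qed

section \<open>Cyclic positions\<close>

lemma lin_adj_mono: "lin_adj f T x y \<Longrightarrow> S \<subseteq> T \<Longrightarrow> lin_adj f S x y"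
  by (auto simp: lin_adj_def)

lemma cyc_adj_mono: "cyc_adj f T x y \<Longrightarrow> S \<subseteq> T \<Longrightarrow> cyc_adj f S x y"
  by (auto simp: cyc_adj_def)

lemma lin_adj_commute: "lin_adj f S x y \<longleftrightarrow> lin_adj f S y x"
  by (simp add: lin_adj_def between_commute)

lemma cyc_adj_commute: "cyc_adj f S x y \<longleftrightarrow> cyc_adj f S y x"
  by (auto simp: cyc_adj_def)

lemma lin_adj_refl [simp]: "lin_adj f S x x"
  by (auto simp: lin_adj_def between_def)

lemma cyc_adj_refl [simp]: "cyc_adj f S x x"
  by (auto simp: cyc_adj_def arc_def)

text \<open>
  The first point lies on the arc that wraps around, so only the other arc between two
  later points can be empty.
\<close>

lemma cyc_adj_iff_lin_adj:
  assumes "s \<in> S" "f s < f x" "f s < f y" "f x \<noteq> f y"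
  shows "cyc_adj f S x y \<longleftrightarrow> lin_adj f S x y"
proof -
  have "cyc_adj f S x y \<longleftrightarrow> lin_adj f S x y" if "f s < f x" "f x < f y" for x y
  proof -
    have "arc f x z y \<longleftrightarrow> between f x z y" for z
      using that by (auto simp: arc_def between_def)
    moreover have "arc f y s x" using that by (auto simp: arc_def)
    ultimately show ?thesis using assms(1) by (auto simp: cyc_adj_def lin_adj_def)
  qed
  then show ?thesis
    using assms by (metis cyc_adj_commute lin_adj_commute linorder_neqE)
qed

text \<open>
  The cyclic order allows any point to be made the first one: shift all earlier positions past the
  end.
\<close>

lemma cut_circle:
  fixes f :: "'a \<Rightarrow> int"
  assumes "finite U" "inj_on f U" "s \<in> U"
  obtains f' where "inj_on f' U" "\<And>x. x \<in> U \<Longrightarrow> x \<noteq> s \<Longrightarrow> f' s < f' x"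
    "\<And>x y z. x \<in> U \<Longrightarrow> y \<in> U \<Longrightarrow> z \<in> U \<Longrightarrow> arc f' x z y \<longleftrightarrow> arc f x z y"
proof -
  obtain N where N: "\<And>x. x \<in> U \<Longrightarrow> \<bar>f x\<bar> < N"
  proof
    fix x assume "x \<in> U"
    then have "\<bar>f x\<bar> \<le> (\<Sum>x\<in>U. \<bar>f x\<bar>)" using assms(1) by (intro member_le_sum) auto
    then show "\<bar>f x\<bar> < (\<Sum>x\<in>U. \<bar>f x\<bar>) + 1" by simp
  qed
  \<comment> \<open>shifting by \<open>2 * N\<close> clears the whole range of positions\<close>
  define f' where "f' = (\<lambda>x. if f x < f s then f x + 2 * N else f x)"
  have lt: "f x < f y + 2 * N" if "x \<in> U" "y \<in> U" for x y
    using N[OF that(1)] N[OF that(2)] by linarith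
  show thesis
  proof
    show "inj_on f' U"
    proof (rule inj_onI)
      fix x y assume "x \<in> U" "y \<in> U" "f' x = f' y"
      then have "f x = f y" using lt[of x y] lt[of y x] by (auto simp: f'_def split: if_splits)
      then show "x = y" using assms(2) \<open>x \<in> U\<close> \<open>y \<in> U\<close> by (auto simp: inj_on_def)
    qed
  next
    fix x assume "x \<in> U" "x \<noteq> s"
    then have "f x \<noteq> f s" using assms by (auto simp: inj_on_def)
    then show "f' s < f' x" using lt[of s x] \<open>x \<in> U\<close> assms(3) by (auto simp: f'_def)
  next
    fix x y z assume "x \<in> U" "y \<in> U" "z \<in> U"
    then show "arc f' x z y \<longleftrightarrow> arc f x z y"
      using lt[of x y] lt[of y x] lt[of x z] lt[of z x] lt[of y z] lt[of z y]
      by (auto simp: f'_def arc_def)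
  qed
qed

lemma cyc_adj_cong:
  assumes "\<And>x y z. x \<in> U \<Longrightarrow> y \<in> U \<Longrightarrow> z \<in> U \<Longrightarrow> arc f' x z y \<longleftrightarrow> arc f x z y"
    and "S \<subseteq> U" "x \<in> U" "y \<in> U"
  shows "cyc_adj f' S x y \<longleftrightarrow> cyc_adj f S x y"
proof -
  have "arc f' x z y = arc f x z y" "arc f' y z x = arc f y z x" if "z \<in> S" for z
    using assms that by (auto intro!: assms(1))
  then show ?thesis unfolding cyc_adj_def by simp
qed

lemma cyc_king_cong:
  assumes "\<And>x y z. x \<in> U \<Longrightarrow> y \<in> U \<Longrightarrow> z \<in> U \<Longrightarrow> arc f' x z y \<longleftrightarrow> arc f x z y"
    and "S \<subseteq> U"
  shows "cyc_king f' g S \<longleftrightarrow> cyc_king f g S"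
proof -
  have "cyc_adj f' S x y \<longleftrightarrow> cyc_adj f S x y" if "x \<in> S" "y \<in> S" for x y
    using cyc_adj_cong[of U f' f S x y] assms that by blast
  then show ?thesis by (simp add: cyc_king_def)
qed

lemma crossing_insert_min_cyc_king:
  assumes cr: "crossing f g a b c d"
    and s: "\<And>x. x \<in> {a, b, c, d} \<Longrightarrow> f s < f x \<and> g s < g x"
  shows "cyc_king f g {s, a, b, c, d}"
  unfolding cyc_king_def
proof (intro ballI impI notI)
  let ?Q = "{s, a, b, c, d}"
  fix x y
  assume xy: "x \<in> ?Q" "y \<in> ?Q" "x \<noteq> y" "cyc_adj f ?Q x y \<and> lin_adj g ?Q x y"
  have nos: False if y: "y \<in> {a, b, c, d}" and adj: "cyc_adj f ?Q s y" "lin_adj g ?Q s y" for y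
  proof -
    have s': "f s < f a" "g s < g a" "g s < g b" "g s < g c" "g s < g d" using s by auto
    have "lin_adj g {a, b, c, d} s y" using adj(2) by (rule lin_adj_mono) auto
    then have n: "\<not> between g s a y" "\<not> between g s b y" "\<not> between g s c y"
      by (auto simp: lin_adj_def)
    \<comment> \<open>only the smallest of the four values is adjacent to \<open>s\<close>, and it sits in the middle\<close>
    have "y = b \<or> y = c"
      using y n s' cr by (auto simp: crossing_def between_def)
    moreover have "arc f s a y \<and> arc f y d s" if "y = b \<or> y = c"
      using that s' cr by (auto simp: crossing_def arc_def)
    ultimately show False using adj(1) by (auto simp: cyc_adj_def)
  qed
  show False
  proof (cases "x = s \<or> y = s")
    case True
    then show False using nos[of x] nos[of y] xy by (auto simp: cyc_adj_commute lin_adj_commute)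
  next
    case False
    then have xy': "x \<in> {a, b, c, d}" "y \<in> {a, b, c, d}" using xy by auto
    have "f x \<noteq> f y" using xy' xy(3) cr by (auto simp: crossing_def)
    then have "lin_adj f ?Q x y"
      using xy(4) cyc_adj_iff_lin_adj[of s ?Q f x y] s xy' by auto
    then have "lin_adj f {a, b, c, d} x y" by (rule lin_adj_mono) auto
    moreover have "lin_adj g {a, b, c, d} x y"
      by (rule lin_adj_mono[of g ?Q]) (use xy(4) in auto)
    ultimately show False using crossing_king[OF cr] xy' xy(3) by (auto simp: king_def)
  qed
qed

text \<open>
  Cut the circle at the point \<open>s\<close> of smallest value. Removing \<open>s\<close> creates no pair that is adjacent in
  the resulting linear order: its two neighbours on the circle become the two ends, and its
  value separates nothing. What is left is therefore a linear king set; it contains 2413 or 3142,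
  and putting \<open>s\<close> back gives a cylindrical king set.
\<close>

lemma cyc_king_has_five:
  assumes "finite U" "2 \<le> card U" "inj_on f U" "inj_on g U" "cyc_king f g U"
  shows "\<exists>Q\<subseteq>U. card Q = 5 \<and> cyc_king f g Q"
proof -
  have "U \<noteq> {}" using assms(2) by auto
  then obtain s where s: "s \<in> U" and "\<And>x. x \<in> U \<Longrightarrow> g s \<le> g x"
    using assms(1) ex_min_if_finite[of "g ` U"] by (force simp: not_less)
  then have smin: "g s < g x" if "x \<in> U" "x \<noteq> s" for x
    using that assms(4) by (metis inj_on_contraD order_le_less)
  obtain f' where f': "inj_on f' U" "\<And>x. x \<in> U \<Longrightarrow> x \<noteq> s \<Longrightarrow> f' s < f' x"
    and arc: "\<And>x y z. x \<in> U \<Longrightarrow> y \<in> U \<Longrightarrow> z \<in> U \<Longrightarrow> arc f' x z y \<longleftrightarrow> arc f x z y"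
    using cut_circle[OF assms(1,3) s] by metis
  have ck: "cyc_king f' g U" using assms(5) cyc_king_cong[OF arc] by auto
  define R where "R = U - {s}"
  have fin: "finite R" using assms by (simp add: R_def)
  have "king f' g R" unfolding king_def
  proof (intro ballI impI notI)
    fix x y assume xy: "x \<in> R" "y \<in> R" "x \<noteq> y" "lin_adj f' R x y \<and> lin_adj g R x y"
    have lt: "f' s < f' x" "f' s < f' y" "g s < g x" "g s < g y"
      using xy f'(2) smin by (auto simp: R_def)
    have U: "U = insert s R" using s by (auto simp: R_def)
    have "lin_adj f' U x y" "lin_adj g U x y"
      using xy(4) lt unfolding U by (auto simp: lin_adj_def between_def)
    moreover have "f' x \<noteq> f' y" using xy f'(1) by (auto simp: R_def inj_on_def)
    ultimately have "cyc_adj f' U x y \<and> lin_adj g U x y"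
      using cyc_adj_iff_lin_adj[of s U f' x y] s lt by auto
    then show False using ck xy by (auto simp: cyc_king_def R_def)
  qed
  moreover have "2 \<le> card R"
  proof (rule ccontr)
    assume "\<not> 2 \<le> card R"
    then have "card R = 1" using assms(1,2) s by (auto simp: R_def)
    then obtain y where "R = {y}" by (auto simp: card_1_singleton_iff)
    then have "U = {s, y}" "s \<noteq> y" using s by (auto simp: R_def)
    then show False using ck by (auto simp: cyc_king_def cyc_adj_def lin_adj_def arc_def between_def)
  qed
  moreover have "inj_on f' R" "inj_on g R"
    using f'(1) assms(4) by (auto simp: R_def intro: inj_on_subset)
  ultimately obtain a b c d where Q: "a \<in> R" "b \<in> R" "c \<in> R" "d \<in> R" and cr: "crossing f' g a b c d"
    using king_has_crossing[OF fin] by blast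
  have "cyc_king f' g {s, a, b, c, d}"
    using crossing_insert_min_cyc_king[OF cr] Q f'(2) smin by (auto simp: R_def)
  moreover have "{s, a, b, c, d} \<subseteq> U" using Q s by (auto simp: R_def)
  moreover have "card {s, a, b, c, d} = 5"
  proof -
    have "distinct [s, a, b, c, d]" using Q cr by (auto simp: R_def crossing_def)
    then show ?thesis using distinct_card by fastforce
  qed
  ultimately show ?thesis using cyc_king_cong[OF arc] by blast
qed

section \<open>Clusters around the points of a smaller king set\<close>

definition near :: "('a \<Rightarrow> int) \<Rightarrow> ('a \<Rightarrow> int) \<Rightarrow> 'a set \<Rightarrow> 'a \<Rightarrow> 'a \<Rightarrow> bool" where
  "near f g P y p \<longleftrightarrow> p \<in> P \<and> cyc_adj f (insert y P) y p \<and> lin_adj g (insert y P) y p"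

text \<open>
  Points \<open>z1\<close> and \<open>z2\<close> of \<open>P\<close> on the two arcs between \<open>p\<close> and \<open>q\<close> would confine \<open>x\<close> to the
  arc around \<open>p\<close> and \<open>y\<close> to the arc around \<open>q\<close>, hence would separate \<open>x\<close> from \<open>y\<close> both ways.
\<close>

lemma arc_chain_cyc_adj:
  assumes "cyc_adj f (insert x P) x p" "cyc_adj f (insert y P) y q" "cyc_adj f P x y"
    and inP: "p \<in> P" "q \<in> P" "x \<in> P \<longrightarrow> x = p" "y \<in> P \<longrightarrow> y = q"
    and inj: "inj_on f (insert x (insert y P))"
  shows "cyc_adj f P p q"
proof (rule ccontr)
  assume "\<not> ?thesis"
  then obtain z1 z2 where z: "z1 \<in> P" "z2 \<in> P" and arcs: "arc f p z1 q" "arc f q z2 p"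
    by (auto simp: cyc_adj_def)
  have ne: "z \<in> P \<Longrightarrow> z \<noteq> p \<Longrightarrow> f z \<noteq> f x" "z \<in> P \<Longrightarrow> z \<noteq> q \<Longrightarrow> f z \<noteq> f y" for z
    using inj inP by (auto simp: inj_on_def)
  have d: "z1 \<noteq> p" "z1 \<noteq> q" "z2 \<noteq> p" "z2 \<noteq> q" using arcs by (auto simp: arc_def)
  have "p \<noteq> q" using arcs by (auto simp: arc_def)
  have 1: "f z1 \<noteq> f x" "f z2 \<noteq> f x" "f q \<noteq> f x" "f z1 \<noteq> f y" "f z2 \<noteq> f y" "f p \<noteq> f y"
    using ne z d inP \<open>p \<noteq> q\<close> by auto
  have 2: "(\<not> arc f x z1 p \<and> \<not> arc f x z2 p \<and> \<not> arc f x q p) \<or> (\<not> arc f p z1 x \<and> \<not> arc f p z2 x \<and> \<not> arc f p q x)"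
    using assms(1) z inP by (auto simp: cyc_adj_def)
  have 3: "(\<not> arc f y z1 q \<and> \<not> arc f y z2 q \<and> \<not> arc f y p q) \<or> (\<not> arc f q z1 y \<and> \<not> arc f q z2 y \<and> \<not> arc f q p y)"
    using assms(2) z inP by (auto simp: cyc_adj_def)
  have 4: "(\<not> arc f x z1 y \<and> \<not> arc f x z2 y \<and> \<not> arc f x p y \<and> \<not> arc f x q y)
      \<or> (\<not> arc f y z1 x \<and> \<not> arc f y z2 x \<and> \<not> arc f y p x \<and> \<not> arc f y q x)"
    using assms(3) z inP by (auto simp: cyc_adj_def)
  show False using 1 2 3 4 arcs unfolding arc_def by (smt (verit))
qed

lemma between_chain_lin_adj:
  assumes "lin_adj g (insert x P) x p" "lin_adj g (insert y P) y q" "lin_adj g P x y"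
    and inP: "x \<in> P \<longrightarrow> x = p" "y \<in> P \<longrightarrow> y = q"
    and inj: "inj_on g (insert x (insert y P))"
  shows "lin_adj g P p q"
  unfolding lin_adj_def
proof
  fix z assume z: "z \<in> P"
  have "z = x \<Longrightarrow> z = p" "z = y \<Longrightarrow> z = q" using inP z by auto
  moreover have "z \<noteq> x \<Longrightarrow> g z \<noteq> g x" "z \<noteq> y \<Longrightarrow> g z \<noteq> g y" using inj z by (auto simp: inj_on_def)
  moreover have "\<not> between g x z p" "\<not> between g y z q" "\<not> between g x z y"
    using assms z by (auto simp: lin_adj_def)
  ultimately show "\<not> between g p z q" unfolding between_def by (smt (verit))
qed

locale cyc_king_subset =
  fixes f g :: "'a \<Rightarrow> int" and U P :: "'a set"
  assumes finU: "finite U" and injf: "inj_on f U" and injg: "inj_on g U"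
    and PU: "P \<subseteq> U" and ckP: "cyc_king f g P" and cardP: "2 \<le> card P"
begin

lemma near_self: "p \<in> P \<Longrightarrow> near f g P p p"
  by (simp add: near_def)

lemma near_in_P: "near f g P x p \<Longrightarrow> x \<in> P \<Longrightarrow> x = p"
  using ckP by (auto simp: near_def cyc_king_def insert_absorb)

lemma other_in_P: obtains r where "r \<in> P" "r \<noteq> p"
proof -
  have "P \<noteq> {p}" "P \<noteq> {}" using cardP by auto
  then show ?thesis using that by blast
qed

text \<open>
  Points outside \<open>P\<close> that are near some point of \<open>P\<close> form clusters around the points of \<open>P\<close>.
  Adjacency never joins two clusters, since their centres would then be adjacent in \<open>P\<close>. In particular
  (with \<open>x = y\<close>) each such point has only one centre.
\<close>

lemma adj_near_eq:
  assumes "near f g P x p" "near f g P y q" "cyc_adj f P x y" "lin_adj g P x y" "x \<in> U" "y \<in> U"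
  shows "p = q"
proof (rule ccontr)
  assume "p \<noteq> q"
  have sub: "insert x (insert y P) \<subseteq> U" using assms PU by auto
  note inj = inj_on_subset[OF injf sub] inj_on_subset[OF injg sub]
  have "cyc_adj f P p q"
    using arc_chain_cyc_adj[of f x P p y q] assms inj near_in_P by (auto simp: near_def)
  moreover have "lin_adj g P p q"
    using between_chain_lin_adj[of g x P p y q] assms inj near_in_P by (auto simp: near_def)
  ultimately show False using ckP assms \<open>p \<noteq> q\<close> by (auto simp: cyc_king_def near_def)
qed

lemma not_cyc_king_insert:
  assumes "y \<in> U - P" "\<not> cyc_king f g (insert y P)"
  shows "\<exists>p. near f g P y p"
proof -
  obtain u v where uv: "u \<in> insert y P" "v \<in> insert y P" "u \<noteq> v"
    and adj: "cyc_adj f (insert y P) u v" "lin_adj g (insert y P) u v"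
    using assms(2) by (auto simp: cyc_king_def)
  have "cyc_adj f P u v" "lin_adj g P u v"
    using cyc_adj_mono[OF adj(1)] lin_adj_mono[OF adj(2)] by auto
  then have "\<not> (u \<in> P \<and> v \<in> P)" using ckP uv(3) by (auto simp: cyc_king_def)
  then show ?thesis using uv adj by (auto simp: near_def cyc_adj_commute lin_adj_commute)
qed

text \<open>
  By \<open>adj_near_eq\<close> an adjacent pair after adding \<open>y\<close> and \<open>z\<close> could only be \<open>y, p\<close> or \<open>z, q\<close>, and each of these is
  assumed to be separated already by one of the four points.
\<close>

lemma interleaved_cyc_king:
  assumes y: "y \<in> U - P" "near f g P y p" and z: "z \<in> U - P" "near f g P z q" and pq: "p \<noteq> q"
    and sep: "\<not> (cyc_adj f {y, z, p, q} y p \<and> lin_adj g {y, z, p, q} y p)"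
             "\<not> (cyc_adj f {y, z, p, q} z q \<and> lin_adj g {y, z, p, q} z q)"
  shows "cyc_king f g (insert y (insert z P))"
  unfolding cyc_king_def
proof (intro ballI impI notI)
  let ?X = "insert y (insert z P)"
  define c where "c = (\<lambda>u. if u = y then p else if u = z then q else u)"
  have P: "p \<in> P" "q \<in> P" using y z by (auto simp: near_def)
  have near: "near f g P u (c u)" if "u \<in> ?X" for u
    using that y z near_self by (auto simp: c_def)
  fix u v assume uv: "u \<in> ?X" "v \<in> ?X" "u \<noteq> v" and adj: "cyc_adj f ?X u v \<and> lin_adj g ?X u v"
  have "cyc_adj f P u v" "lin_adj g P u v"
    using adj cyc_adj_mono[of f ?X u v P] lin_adj_mono[of g ?X u v P] by auto
  then have "c u = c v" using adj_near_eq[OF near near] uv y z PU by auto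
  then have "{u, v} = {y, p} \<or> {u, v} = {z, q}"
    using uv pq y z by (auto simp: c_def split: if_splits)
  moreover have "cyc_adj f {y, z, p, q} u v" "lin_adj g {y, z, p, q} u v"
    using adj cyc_adj_mono[of f ?X u v "{y, z, p, q}"] lin_adj_mono[of g ?X u v "{y, z, p, q}"] P by auto
  ultimately show False
    using sep by (auto simp: doubleton_eq_iff cyc_adj_commute lin_adj_commute)
qed

text \<open>
  In value the four points come in the order \<open>p, z, y, q\<close> or its reverse: \<open>z\<close> separates
  \<open>p\<close> from \<open>y\<close>, and \<open>y\<close> separates \<open>z\<close> from \<open>q\<close>.
\<close>

lemma value_interleaved_cyc_king:
  assumes y: "y \<in> U - P" "near f g P y p" and z: "z \<in> U - P" "near f g P z q" and pq: "p \<noteq> q"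
    and pzy: "between g p z y"
  shows "cyc_king f g (insert y (insert z P))"
proof (rule interleaved_cyc_king[OF y z pq])
  have P: "p \<in> P" "q \<in> P" using y z by (auto simp: near_def)
  have "\<not> between g y q p" "\<not> between g z p q"
    using y z P by (auto simp: near_def lin_adj_def)
  moreover have "g p \<noteq> g q" "g q \<noteq> g y"
    using P pq y z injg PU by (auto simp: inj_on_def)
  ultimately have "between g z y q" using pzy unfolding between_def by (smt (verit))
  then show "\<not> (cyc_adj f {y, z, p, q} z q \<and> lin_adj g {y, z, p, q} z q)"
    by (auto simp: lin_adj_def)
  show "\<not> (cyc_adj f {y, z, p, q} y p \<and> lin_adj g {y, z, p, q} y p)"
    using pzy by (auto simp: lin_adj_def between_commute)
qed

text \<open>
  The same in cyclic position. Here a pair has to be separated on both arcs; the second arc is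
  blocked by the centre of the other pair.
\<close>

lemma arc_interleaved_cyc_king:
  assumes y: "y \<in> U - P" "near f g P y p" and z: "z \<in> U - P" "near f g P z q" and pq: "p \<noteq> q"
    and pzy: "arc f p z y \<and> (\<forall>w\<in>P. \<not> arc f p w y) \<or> arc f y z p \<and> (\<forall>w\<in>P. \<not> arc f y w p)"
  shows "cyc_king f g (insert y (insert z P))"
proof (rule interleaved_cyc_king[OF y z pq])
  have P: "p \<in> P" "q \<in> P" using y z by (auto simp: near_def)
  have ne: "f p \<noteq> f q" "f q \<noteq> f y" "f q \<noteq> f z" "f p \<noteq> f y" "f p \<noteq> f z"
    using P pq y z injf PU by (auto simp: inj_on_def)
  have 1: "arc f p z y \<and> \<not> arc f p q y \<or> arc f y z p \<and> \<not> arc f y q p"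
    using pzy P by auto
  have "arc f y z p \<and> arc f p q y \<or> arc f p z y \<and> arc f y q p"
    using 1 ne unfolding arc_def by (smt (verit))
  then show "\<not> (cyc_adj f {y, z, p, q} y p \<and> lin_adj g {y, z, p, q} y p)"
    by (auto simp: cyc_adj_def)
  have "arc f z y q \<and> arc f q p z \<or> arc f z p q \<and> arc f q y z"
    using 1 ne unfolding arc_def by (smt (verit))
  then show "\<not> (cyc_adj f {y, z, p, q} z q \<and> lin_adj g {y, z, p, q} z q)"
    by (auto simp: cyc_adj_def)
qed

text \<open>
  If no two added points rescue each other, a point of another cluster never lies between two
  points of the cluster of \<open>p\<close>, as it would be interleaved with one of them. Hence
  an adjacent pair in the cluster would also be adjacent in \<open>U\<close>.
\<close>

lemma cluster_cyc_king:
  assumes ckU: "cyc_king f g U" and p: "p \<in> P"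
    and near: "\<And>y. y \<in> U - P \<Longrightarrow> \<exists>p. near f g P y p"
    and no: "\<And>y z. y \<in> U - P \<Longrightarrow> z \<in> U - P \<Longrightarrow> \<not> cyc_king f g (insert y (insert z P))"
  shows "cyc_king f g (P \<union> {y \<in> U - P. near f g P y p})"
  unfolding cyc_king_def
proof (intro ballI impI notI)
  let ?T = "P \<union> {y \<in> U - P. near f g P y p}"
  define c where "c = (\<lambda>u. if u \<in> P then u else p)"
  fix x y assume xy: "x \<in> ?T" "y \<in> ?T" "x \<noteq> y" and adj: "cyc_adj f ?T x y \<and> lin_adj g ?T x y"
  have nearc: "near f g P u (c u)" if "u \<in> ?T" for u
    using that near_self by (auto simp: c_def)
  have "cyc_adj f P x y" "lin_adj g P x y"
    using adj cyc_adj_mono[of f ?T x y P] lin_adj_mono[of g ?T x y P] by auto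
  then have "c x = c y" using adj_near_eq[OF nearc nearc] xy PU by auto
  then have nx: "near f g P x p" and ny: "near f g P y p"
    and xP: "x \<in> P \<Longrightarrow> x = p" and yP: "y \<in> P \<Longrightarrow> y = p"
    using nearc xy near_self by (auto simp: c_def split: if_splits)
  have xyU: "x \<in> U" "y \<in> U" using xy PU by auto
  have out: "z \<in> U - P \<and> (\<exists>q. near f g P z q \<and> p \<noteq> q)" if "z \<in> U" "z \<notin> ?T" for z
    using that near[of z] by auto
  have lin: "lin_adj g U x y"
  proof (rule ccontr)
    assume "\<not> ?thesis"
    then obtain z where z: "z \<in> U" "between g x z y" by (auto simp: lin_adj_def)
    then have zT: "z \<notin> ?T" using adj by (auto simp: lin_adj_def)
    obtain q where q: "near f g P z q" "p \<noteq> q" using out[OF z(1) zT] by auto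
    have zP: "z \<in> U - P" using out[OF z(1) zT] by auto
    have "g z \<noteq> g p" using zT z(1) p PU injg by (auto simp: inj_on_def)
    then have "between g p z x \<or> between g p z y"
      using z(2) unfolding between_def by linarith
    then show False
    proof
      assume b: "between g p z x"
      then have "x \<in> U - P" using xP xyU by (auto simp: between_def)
      then show False using value_interleaved_cyc_king[OF _ nx zP q b] no zP by auto
    next
      assume b: "between g p z y"
      then have "y \<in> U - P" using yP xyU by (auto simp: between_def)
      then show False using value_interleaved_cyc_king[OF _ ny zP q b] no zP by auto
    qed
  qed
  have key: False if xy: "{x', y'} = {x, y}" "x' \<noteq> y'" and emp: "\<forall>z\<in>?T. \<not> arc f x' z y'"
    and z: "z \<in> U" "arc f x' z y'" for x' y' z
  proof -
    have zT: "z \<notin> ?T" using emp z by auto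
    obtain q where q: "near f g P z q" "p \<noteq> q" using out[OF z(1) zT] by auto
    have zP: "z \<in> U - P" using out[OF z(1) zT] by auto
    have n: "near f g P x' p" "near f g P y' p" using xy nx ny by (auto simp: doubleton_eq_iff)
    have xP': "x' \<in> P \<Longrightarrow> x' = p" "y' \<in> P \<Longrightarrow> y' = p" and U': "x' \<in> U" "y' \<in> U"
      using xy xP yP xyU by (auto simp: doubleton_eq_iff)
    have empP: "\<not> arc f x' w y'" if "w \<in> P" for w using emp that by auto
    consider "x' = p" | "y' = p" | "x' \<noteq> p" "y' \<noteq> p" by auto
    then show False
    proof cases
      case 1
      then have "y' \<in> U - P" using xP' U' xy(2) by auto
      then show False using arc_interleaved_cyc_king[OF _ n(2) zP q] no zP 1 z empP by blast
    next
      case 2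
      then have "x' \<in> U - P" using xP' U' xy(2) by auto
      then show False using arc_interleaved_cyc_king[OF _ n(1) zP q] no zP 2 z empP by blast
    next
      case 3
      then have U'': "x' \<in> U - P" "y' \<in> U - P" using xP' U' by auto
      obtain r where r: "r \<in> P" "r \<noteq> p" by (rule other_in_P)
      have ne: "f p \<noteq> f x'" "f p \<noteq> f y'" "f p \<noteq> f z" "f r \<noteq> f p" "f r \<noteq> f x'" "f r \<noteq> f y'"
        using U'' zP r p PU injf by (auto simp: inj_on_def)
      have 0: "\<not> arc f x' r y'" "\<not> arc f x' p y'" using empP r p by auto
      have "arc f x' z p \<and> (\<forall>w\<in>P. \<not> arc f x' w p) \<or> arc f p z y' \<and> (\<forall>w\<in>P. \<not> arc f p w y')"
      proof -
        \<comment> \<open>the cyclic order is \<open>p, x', z, y'\<close>; if the arcs from \<open>x'\<close> up to \<open>p\<close> and from \<open>p\<close> up to \<open>y'\<close>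
          both met \<open>P\<close>, the other two arcs at \<open>p\<close> would miss it, leaving no place for \<open>r\<close>\<close>
        have a: "arc f x' z p" "arc f p z y'" using z(2) 0 ne unfolding arc_def by (smt (verit))+
        have "\<not> (\<not> arc f p r x' \<and> \<not> arc f y' r p)"
          using 0 ne unfolding arc_def by (smt (verit))
        moreover have "(\<forall>w\<in>P. \<not> arc f x' w p) \<or> (\<forall>w\<in>P. \<not> arc f p w x')"
          "(\<forall>w\<in>P. \<not> arc f y' w p) \<or> (\<forall>w\<in>P. \<not> arc f p w y')"
          using n by (auto simp: near_def cyc_adj_def)
        ultimately show ?thesis using a r by blast
      qed
      then show False
        using arc_interleaved_cyc_king[OF U''(1) n(1) zP q] arc_interleaved_cyc_king[OF U''(2) n(2) zP q]
          no[OF U''(1) zP] no[OF U''(2) zP] by blast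
    qed
  qed
  have "cyc_adj f ?T x y" using adj by simp
  then have "cyc_adj f U x y"
    unfolding cyc_adj_def
  proof (rule disj_forward)
    assume e: "\<forall>z\<in>?T. \<not> arc f x z y"
    show "\<forall>z\<in>U. \<not> arc f x z y" using key[OF refl xy(3) e] by blast
  next
    assume e: "\<forall>z\<in>?T. \<not> arc f y z x"
    show "\<forall>z\<in>U. \<not> arc f y z x" using key[OF insert_commute xy(3)[symmetric] e] by blast
  qed
  then show False using ckU lin xyU xy(3) by (auto simp: cyc_king_def)
qed

text \<open>
  When \<open>U\<close> consists of \<open>P\<close> and one cluster, the cluster with its centre \<open>p\<close> is an interval \<open>B\<close> of
  \<open>U\<close>, inflating \<open>p\<close>. With the circle cut at \<open>s\<close>, outside \<open>B\<close>, this interval is a linear king set of at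
  least six points, so a king set \<open>K\<close> of size four or five through \<open>p\<close> can replace it. This is
  where the bound four comes from: five removable points leave room for \<open>K\<close>.
\<close>

lemma single_cluster_intermediate:
  assumes ckU: "cyc_king f g U" and p: "p \<in> P" and near: "\<And>y. y \<in> U - P \<Longrightarrow> near f g P y p"
    and s: "s \<in> P" "s \<noteq> p" "\<And>x. x \<in> U \<Longrightarrow> x \<noteq> s \<Longrightarrow> f s < f x"
    and card: "5 \<le> card (U - P)"
  shows "\<exists>T. P \<subset> T \<and> T \<subset> U \<and> cyc_king f g T"
proof -
  define B where "B = insert p (U - P)"
  have BU: "B \<subseteq> U" using p PU by (auto simp: B_def)
  have fin: "finite B" using BU finU by (rule finite_subset)
  have cardB: "card B = Suc (card (U - P))" using finU p by (simp add: B_def)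
  have injB: "inj_on f B" "inj_on g B" using inj_on_subset[OF injf BU] inj_on_subset[OF injg BU] .
  have sB: "f s < f x" if "x \<in> B" for x using that s PU p by (auto simp: B_def)
  have nearB: "near f g P x p" if "x \<in> B" for x
    using that near near_self p by (auto simp: B_def)
  have "king f g B" unfolding king_def
  proof (intro ballI impI notI)
    fix x y assume xy: "x \<in> B" "y \<in> B" "x \<noteq> y" and adj: "lin_adj f B x y \<and> lin_adj g B x y"
    have linf: "lin_adj f (insert u P) u p" if "u \<in> B" for u
    proof (cases "u = p")
      case False
      then have "f u \<noteq> f p" using that p BU PU injf by (auto simp: inj_on_def)
      then show ?thesis
        using nearB[OF that] cyc_adj_iff_lin_adj[of s "insert u P" f u p] s sB[OF that] sB[of p]
        by (auto simp: near_def B_def)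
    qed simp
    have "lin_adj h U x y" if h: "h \<in> {f, g}" for h
      unfolding lin_adj_def
    proof
      fix r assume r: "r \<in> U"
      show "\<not> between h x r y"
      proof (cases "r \<in> B")
        case True
        then show ?thesis using adj h by (auto simp: lin_adj_def)
      next
        case False
        then have rP: "r \<in> P" "r \<noteq> p" using r by (auto simp: B_def)
        have "lin_adj h (insert x P) x p" "lin_adj h (insert y P) y p"
          using linf nearB xy h by (auto simp: near_def)
        then have "\<not> between h x r p" "\<not> between h y r p" using rP by (auto simp: lin_adj_def)
        moreover have "f r \<noteq> f p" "g r \<noteq> g p"
          using inj_on_contraD[OF injf rP(2)] inj_on_contraD[OF injg rP(2)] rP p PU by auto
        ultimately show ?thesis using h unfolding between_def by (elim insertE emptyE; simp; linarith)
      qed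
    qed
    moreover have "f x \<noteq> f y" using inj_on_contraD[OF injB(1) xy(3,1,2)] .
    ultimately have "cyc_adj f U x y \<and> lin_adj g U x y"
      using cyc_adj_iff_lin_adj[of s U f x y] s(1) PU sB xy by auto
    then show False using ckU xy BU by (auto simp: cyc_king_def)
  qed
  then obtain K where K: "K \<subseteq> B" "p \<in> K" "card K \<in> {4, 5}" "king f g K"
    using king_small_through_point[OF fin _ injB, of p] cardB card by (auto simp: B_def)
  have "cyc_king f g (P \<union> K)" unfolding cyc_king_def
  proof (intro ballI impI notI)
    let ?T = "P \<union> K"
    fix x y assume xy: "x \<in> ?T" "y \<in> ?T" "x \<noteq> y" and adj: "cyc_adj f ?T x y \<and> lin_adj g ?T x y"
    define c where "c = (\<lambda>u. if u \<in> P then u else p)"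
    have near': "near f g P u (c u)" if "u \<in> ?T" for u
      using that near_self nearB K(1) by (auto simp: c_def)
    have "cyc_adj f P x y" "lin_adj g P x y"
      using adj cyc_adj_mono[of f ?T x y P] lin_adj_mono[of g ?T x y P] by auto
    moreover have "x \<in> U" "y \<in> U" using xy PU K(1) BU by auto
    ultimately have "c x = c y" by (intro adj_near_eq[OF near'[OF xy(1)] near'[OF xy(2)]])
    then have xyK: "x \<in> K" "y \<in> K" using xy K(2) by (auto simp: c_def split: if_splits)
    then have xyB: "x \<in> B" "y \<in> B" using K(1) by auto
    then have "f x \<noteq> f y" "f s < f x" "f s < f y"
      using inj_on_contraD[OF injB(1) xy(3)] sB by auto
    then have "lin_adj f ?T x y" using adj cyc_adj_iff_lin_adj[of s ?T f x y] s(1) by auto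
    then have "lin_adj f K x y" "lin_adj g K x y"
      using adj lin_adj_mono[of _ ?T x y K] by auto
    then show False using K(4) xyK xy(3) by (auto simp: king_def)
  qed
  moreover have "P \<subset> P \<union> K"
  proof -
    have "\<not> K \<subseteq> {p}" using K(3) card_mono[of "{p}" K] by auto
    then show ?thesis using K(1) by (auto simp: B_def)
  qed
  moreover have "P \<union> K \<subset> U"
  proof -
    have "card K < card B" using K(3) cardB card by auto
    then have "K \<noteq> B" by auto
    then show ?thesis using K(1,2) BU PU p by (auto simp: B_def)
  qed
  ultimately show ?thesis by blast
qed

text \<open>
  Suppose nothing lies strictly between. Then no one or two points can be added to \<open>P\<close>, so every point of
  \<open>U - P\<close> lies in a cluster and the clusters do not interleave. Adding one whole cluster to \<open>P\<close>
  must give \<open>U\<close>, and this case is \<open>single_cluster_intermediate\<close>.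
\<close>

lemma intermediate:
  assumes ckU: "cyc_king f g U" and card: "5 \<le> card (U - P)"
  shows "\<exists>T. P \<subset> T \<and> T \<subset> U \<and> cyc_king f g T"
proof (rule ccontr)
  assume none: "\<not> ?thesis"
  have no: "\<not> cyc_king f g (insert y (insert z P))" if "y \<in> U - P" "z \<in> U - P" for y z
  proof
    assume "cyc_king f g (insert y (insert z P))"
    moreover have "insert y (insert z P) \<noteq> U"
    proof
      assume "insert y (insert z P) = U"
      then have "U - P \<subseteq> {y, z}" by auto
      then have "card (U - P) \<le> card {y, z}" by (intro card_mono) auto
      then show False using card by (auto simp: card_insert_if split: if_splits)
    qed
    moreover have "P \<subset> insert y (insert z P)" "insert y (insert z P) \<subseteq> U" using that PU by auto
    ultimately show False using none by (metis psubsetI)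
  qed
  have near: "\<exists>p. near f g P y p" if "y \<in> U - P" for y
    using not_cyc_king_insert[OF that] no[OF that that] by simp
  have "U - P \<noteq> {}" using card by (metis card.empty not_numeral_le_zero)
  then obtain y p where y: "y \<in> U - P" "near f g P y p" using near by blast
  then have p: "p \<in> P" by (simp add: near_def)
  let ?T = "P \<union> {y \<in> U - P. near f g P y p}"
  have "cyc_king f g ?T" using cluster_cyc_king[OF ckU p near no] .
  moreover have "P \<subset> ?T" using y by blast
  ultimately have "?T = U" using none PU by blast
  \<comment> \<open>from here on \<open>U\<close> is a single cluster around \<open>p\<close>\<close>
  then have nearp: "near f g P x p" if "x \<in> U - P" for x using that by blast
  obtain s where s: "s \<in> P" "s \<noteq> p" by (rule other_in_P)
  obtain f' where f': "inj_on f' U" "\<And>x. x \<in> U \<Longrightarrow> x \<noteq> s \<Longrightarrow> f' s < f' x"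
    and arc: "\<And>x y z. x \<in> U \<Longrightarrow> y \<in> U \<Longrightarrow> z \<in> U \<Longrightarrow> arc f' x z y \<longleftrightarrow> arc f x z y"
    using cut_circle[OF finU injf, of s] s(1) PU by (metis subsetD)
  have ck: "cyc_king f' g S \<longleftrightarrow> cyc_king f g S" if "S \<subseteq> U" for S using cyc_king_cong[OF arc that] .
  interpret cut: cyc_king_subset f' g U P
    using finU f'(1) injg PU ck ckP cardP by unfold_locales auto
  have "near f' g P x p" if "x \<in> U - P" for x
    using nearp[OF that] cyc_adj_cong[OF arc, where S = "insert x P" and x = x and y = p] that p PU
    by (auto simp: near_def)
  from cut.single_cluster_intermediate[OF _ p this s f'(2) card]
  obtain T where "P \<subset> T" "T \<subset> U" "cyc_king f' g T" using ck[of U] ckU by auto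
  then show False using none ck[of T] by auto
qed

end

section \<open>Removing at most four points\<close>

lemma cyc_king_chain_step:
  assumes "finite U" "inj_on f U" "inj_on g U" "cyc_king f g U" "cyc_king f g P" "P \<subset> U" "2 \<le> card P"
    and "5 \<le> card (U - P)"
  shows "\<exists>T. P \<subset> T \<and> T \<subset> U \<and> cyc_king f g T \<and> card (U - T) \<le> 4"
  using assms
proof (induction "card (U - P)" arbitrary: P rule: less_induct)
  case less
  interpret cyc_king_subset f g U P using less.prems by unfold_locales auto
  obtain T where T: "P \<subset> T" "T \<subset> U" "cyc_king f g T" using intermediate less.prems by blast
  show ?case
  proof (cases "card (U - T) \<le> 4")
    case False
    have "U - T \<subset> U - P" using T by auto
    then have lt: "card (U - T) < card (U - P)" using finU by (intro psubset_card_mono) auto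
    have "card P \<le> card T" using T finU by (intro card_mono) (auto intro: finite_subset)
    then have "2 \<le> card T" using less.prems by linarith
    then obtain T' where "T \<subset> T'" "T' \<subset> U" "cyc_king f g T'" "card (U - T') \<le> 4"
      using less.hyps[OF lt] less.prems T False by auto
    then show ?thesis using T(1) by (meson psubset_trans)
  qed (use T in blast)
qed

text \<open>
  A single point has no second point of \<open>P\<close> at which to cut the circle, but its pattern is contained in every
  permutation; so \<open>P\<close> may then be replaced by a point of some cylindrical king set of size five.
\<close>

lemma cyc_king_drop_at_most_four:
  assumes "finite U" "inj_on f U" "inj_on g U" "cyc_king f g U" "cyc_king f g P" "P \<subseteq> U" "P \<noteq> {}"
    and "5 \<le> card (U - P)"
  shows "\<exists>P' T. cyc_king f g T \<and> T \<subset> U \<and> card (U - T) \<le> 4 \<and> P' \<subset> T \<and> (P' = P \<or> card P = 1 \<and> card P' = 1)"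
proof (cases "card P = 1")
  case False
  have "finite P" using assms by (auto intro: finite_subset)
  then have "2 \<le> card P" using False assms(7) by (metis One_nat_def Suc_leI card_gt_0_iff le_neq_implies_less one_add_one plus_1_eq_Suc)
  moreover have "P \<subset> U" using assms by auto
  ultimately show ?thesis using cyc_king_chain_step[OF assms(1-5)] assms(8) by blast
next
  case True
  have fin: "finite P" using assms by (auto intro: finite_subset)
  have cardU: "card U = card (U - P) + 1"
    using True assms fin by (simp add: card_Diff_subset card_mono)
  then obtain Q where Q: "Q \<subseteq> U" "card Q = 5" "cyc_king f g Q"
    using cyc_king_has_five[OF assms(1) _ assms(2-4)] assms(8) by auto
  have QU: "Q \<subset> U" using Q cardU assms(8) by auto
  have "\<exists>T. Q \<subseteq> T \<and> T \<subset> U \<and> cyc_king f g T \<and> card (U - T) \<le> 4"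
  proof (cases "card (U - Q) \<le> 4")
    case False
    then have "5 \<le> card (U - Q)" "2 \<le> card Q" using Q(2) by auto
    then show ?thesis using cyc_king_chain_step[OF assms(1-4) Q(3) QU] by blast
  qed (use Q QU in blast)
  then obtain T where T: "Q \<subseteq> T" "T \<subset> U" "cyc_king f g T" "card (U - T) \<le> 4" by blast
  obtain q where "q \<in> Q" using Q(2) by fastforce
  moreover have "Q \<noteq> {q}" using Q(2) by auto
  ultimately have "{q} \<subset> T" using T(1) by auto
  moreover have "card {q} = 1" by simp
  ultimately show ?thesis using T(2-4) True by blast
qed

section \<open>One-line notation\<close>

text \<open>
  Being a cylindrical king set depends only on the order of positions and of values; this carries it
  along order isomorphisms and renumberings.
\<close>

lemma cyc_king_bij_cong:
  assumes bij: "bij_betw e A B"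
    and f: "\<And>x y. x \<in> A \<Longrightarrow> y \<in> A \<Longrightarrow> f' (e x) < f' (e y) \<longleftrightarrow> f x < f y"
    and g: "\<And>x y. x \<in> A \<Longrightarrow> y \<in> A \<Longrightarrow> g' (e x) < g' (e y) \<longleftrightarrow> g x < g y"
  shows "cyc_king f' g' B \<longleftrightarrow> cyc_king f g A"
proof -
  have B: "B = e ` A" and inj: "inj_on e A" using bij by (auto simp: bij_betw_def)
  have "cyc_adj f' B (e x) (e y) \<longleftrightarrow> cyc_adj f A x y"
       "lin_adj g' B (e x) (e y) \<longleftrightarrow> lin_adj g A x y" if "x \<in> A" "y \<in> A" for x y
    using that f g by (simp_all add: B cyc_adj_def lin_adj_def arc_def between_def)
  moreover have "e x = e y \<longleftrightarrow> x = y" if "x \<in> A" "y \<in> A" for x y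
    using inj that by (auto simp: inj_on_def)
  ultimately show ?thesis by (simp add: cyc_king_def B)
qed

definition pos :: "nat \<Rightarrow> int" where "pos = int"
definition val :: "nat list \<Rightarrow> nat \<Rightarrow> int" where "val xs i = int (xs ! i)"

lemma order_isomorphic_cyc_king:
  assumes "order_isomorphic xs ys"
  shows "cyc_king pos (val xs) {..<length xs} \<longleftrightarrow> cyc_king pos (val ys) {..<length ys}"
  using assms by (intro cyc_king_bij_cong[where e = id]) (auto simp: order_isomorphic_def val_def)

definition indices :: "nat list \<Rightarrow> nat set \<Rightarrow> nat list" where
  "indices xs A = filter (\<lambda>i. i \<in> A) [0..<length xs]"

lemma nths_conv_indices: "nths xs A = map ((!) xs) (indices xs A)"
proof -
  have "zip xs [0..<length xs] = map (\<lambda>i. (xs ! i, i)) [0..<length xs]"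
    by (rule nth_equalityI) auto
  then show ?thesis by (simp add: nths_def indices_def filter_map o_def)
qed

lemma length_nths_subset: "A \<subseteq> {..<length xs} \<Longrightarrow> length (nths xs A) = card A"
  unfolding length_nths by (rule arg_cong[where f = card]) auto

lemma cyc_king_nths:
  assumes "A \<subseteq> {..<length xs}"
  shows "cyc_king pos (val (nths xs A)) {..<length (nths xs A)} \<longleftrightarrow> cyc_king pos (val xs) A"
proof -
  define L where "L = indices xs A"
  have L: "set L = A" "distinct L" "sorted_wrt (<) L"
    using assms by (auto simp: L_def indices_def sorted_wrt_filter)
  have len: "length (nths xs A) = length L" by (simp add: nths_conv_indices L_def)
  have mono: "L ! i < L ! j \<longleftrightarrow> i < j" if "i < length L" "j < length L" for i j
    using that sorted_wrt_nth_less[OF L(3), of i j] sorted_wrt_nth_less[OF L(3), of j i]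
    by (cases i j rule: linorder_cases) auto
  have "bij_betw ((!) L) {..<length L} A"
    using L by (simp add: bij_betw_nth)
  then have "cyc_king pos (val xs) A \<longleftrightarrow> cyc_king pos (val (nths xs A)) {..<length L}"
    by (rule cyc_king_bij_cong) (auto simp: pos_def mono val_def nths_conv_indices L_def[symmetric])
  then show ?thesis using len by simp
qed

lemma subseq_nths_mono: "A \<subseteq> B \<Longrightarrow> subseq (nths (xs :: nat list) A) (nths xs B)"
proof -
  assume "A \<subseteq> B"
  then have "indices xs A = filter (\<lambda>i. i \<in> A) (indices xs B)"
    by (auto simp: indices_def intro!: filter_cong)
  then show ?thesis
    unfolding nths_conv_indices by (simp add: subseq_map subseq_filter_left)
qed

text \<open>
  Replacing every entry by its rank turns a list of distinct numbers into the permutation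
  that is order-isomorphic to it.
\<close>

definition rank :: "nat list \<Rightarrow> nat \<Rightarrow> nat" where
  "rank xs v = card {u \<in> set xs. u \<le> v}"

lemma rank_less_iff:
  assumes "u \<in> set xs" "v \<in> set xs"
  shows "rank xs u < rank xs v \<longleftrightarrow> u < v"
proof -
  have "rank xs u < rank xs v" if "u < v" "v \<in> set xs" for u v
  proof -
    have "v \<in> {w \<in> set xs. w \<le> v}" "v \<notin> {w \<in> set xs. w \<le> u}" using that by auto
    moreover have "{w \<in> set xs. w \<le> u} \<subseteq> {w \<in> set xs. w \<le> v}" using that(1) by auto
    ultimately have "{w \<in> set xs. w \<le> u} \<subset> {w \<in> set xs. w \<le> v}" by (metis psubsetI)
    then show ?thesis unfolding rank_def by (intro psubset_card_mono) auto
  qed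
  then show ?thesis using assms by (metis linorder_neqE not_less_iff_gr_or_eq)
qed

lemma order_isomorphic_map:
  assumes "\<And>u v. u \<in> set xs \<Longrightarrow> v \<in> set xs \<Longrightarrow> h u < h v \<longleftrightarrow> u < v"
  shows "order_isomorphic (map h xs) xs"
  using assms by (simp add: order_isomorphic_def)

lemma map_rank_in_perms:
  assumes "distinct xs"
  shows "map (rank xs) xs \<in> perms (length xs)"
proof -
  have "inj_on (rank xs) (set xs)"
  proof (rule inj_onI)
    fix u v assume "u \<in> set xs" "v \<in> set xs" "rank xs u = rank xs v"
    then show "u = v" using rank_less_iff[of u xs v] rank_less_iff[of v xs u] by simp
  qed
  then have "distinct (map (rank xs) xs)" and "card (rank xs ` set xs) = length xs"
    using assms by (auto simp: distinct_map card_image distinct_card)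
  moreover have "rank xs ` set xs \<subseteq> {1..length xs}"
  proof -
    have "1 \<le> rank xs v" "rank xs v \<le> length xs" if "v \<in> set xs" for v
    proof -
      have "0 < card {u \<in> set xs. u \<le> v}" using that by (subst card_gt_0_iff) auto
      then show "1 \<le> rank xs v" by (simp add: rank_def)
      have "rank xs v \<le> card (set xs)" unfolding rank_def by (rule card_mono) auto
      then show "rank xs v \<le> length xs" using card_length le_trans by blast
    qed
    then show ?thesis by auto
  qed
  ultimately have "rank xs ` set xs = {1..length xs}" by (intro card_subset_eq) auto
  with \<open>distinct (map (rank xs) xs)\<close> show ?thesis
    by (auto simp: perms_def permutations_of_set_def)
qed

lemma length_perms: "xs \<in> perms n \<Longrightarrow> length xs = n"
  using length_finite_permutations_of_set[of xs "{1..n}"] by (simp add: perms_def)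

text \<open>
  In a permutation of \<open>{1..n}\<close> every value occurs, so two points are adjacent in value exactly when their
  values differ by at most one; in position the adjacent pairs are the consecutive ones and the two ends.
\<close>

lemma CK_iff_cyc_king:
  assumes "n \<ge> 1"
  shows "xs \<in> CK n \<longleftrightarrow> xs \<in> perms n \<and> cyc_king pos (val xs) {..<n}"
proof (cases "n = 1")
  case True
  then show ?thesis by (auto simp: CK_def cyc_king_def)
next
  case False
  let ?U = "{..<n}"
  have "cyc_king pos (val xs) ?U \<longleftrightarrow>
    (\<forall>i. i + 1 < n \<longrightarrow> \<bar>int (xs ! (i + 1)) - int (xs ! i)\<bar> > 1) \<and> \<bar>int (xs ! 0) - int (xs ! (n - 1))\<bar> > 1"
    if xs: "xs \<in> perms n"
  proof -
    have set: "set xs = {1..n}" and len: "length xs = n"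
      using xs length_perms by (auto simp: perms_def permutations_of_set_def)
    have lin: "lin_adj (val xs) ?U i j \<longleftrightarrow> \<bar>int (xs ! i) - int (xs ! j)\<bar> \<le> 1" if ij: "i < n" "j < n" for i j
    proof
      assume adj: "lin_adj (val xs) ?U i j"
      have mem: "xs ! i \<in> {1..n}" "xs ! j \<in> {1..n}" using ij len set nth_mem by blast+
      define v where "v = Suc (min (xs ! i) (xs ! j))"
      show "\<bar>int (xs ! i) - int (xs ! j)\<bar> \<le> 1"
      proof (rule ccontr)
        assume "\<not> ?thesis"
        then have v: "min (xs ! i) (xs ! j) < v" "v < max (xs ! i) (xs ! j)" by (auto simp: v_def)
        then have "v \<in> set xs" using mem by (auto simp: set)
        then obtain k where "k < n" "xs ! k = v" using len by (auto simp: in_set_conv_nth)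
        then show False using adj v by (auto simp: lin_adj_def between_def val_def min_def max_def split: if_splits)
      qed
    next
      assume "\<bar>int (xs ! i) - int (xs ! j)\<bar> \<le> 1"
      then show "lin_adj (val xs) ?U i j" by (auto simp: lin_adj_def between_def val_def)
    qed
    have cyc: "cyc_adj pos ?U i j \<longleftrightarrow> j = Suc i \<or> (i = 0 \<and> j = n - 1)" if ij: "i < j" "j < n" for i j
    proof
      assume "cyc_adj pos ?U i j"
      then consider "\<forall>z\<in>?U. \<not> arc pos i z j" | "\<forall>z\<in>?U. \<not> arc pos j z i" by (auto simp: cyc_adj_def)
      then show "j = Suc i \<or> (i = 0 \<and> j = n - 1)"
      proof cases
        case 1
        then have "\<not> arc pos i (Suc i) j" using ij by auto
        then show ?thesis using ij by (auto simp: arc_def pos_def)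
      next
        case 2
        then have "\<not> arc pos j 0 i" "\<not> arc pos j (n - 1) i" using ij by auto
        then show ?thesis using ij by (auto simp: arc_def pos_def)
      qed
    next
      assume "j = Suc i \<or> (i = 0 \<and> j = n - 1)"
      then show "cyc_adj pos ?U i j" using ij by (auto simp: cyc_adj_def arc_def pos_def)
    qed
    have "cyc_king pos (val xs) ?U \<longleftrightarrow> (\<forall>i j. i < j \<and> j < n \<longrightarrow> \<not> (cyc_adj pos ?U i j \<and> lin_adj (val xs) ?U i j))"
      (is "?ck \<longleftrightarrow> ?ordered")
    proof
      assume ?ordered
      then have no: "\<not> (cyc_adj pos ?U i j \<and> lin_adj (val xs) ?U i j)" if "i < j" "j < n" for i j
        using that by blast
      show ?ck unfolding cyc_king_def
      proof (intro ballI impI)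
        fix i j assume ij: "i \<in> ?U" "j \<in> ?U" "i \<noteq> j"
        consider "i < j" | "j < i" using ij(3) by linarith
        then show "\<not> (cyc_adj pos ?U i j \<and> lin_adj (val xs) ?U i j)"
          using no[of i j] no[of j i] ij by cases (simp_all add: cyc_adj_commute lin_adj_commute)
      qed
    qed (auto simp: cyc_king_def)
    also have "\<dots> \<longleftrightarrow> (\<forall>i j. i < j \<and> j < n \<and> (j = Suc i \<or> (i = 0 \<and> j = n - 1)) \<longrightarrow> \<bar>int (xs ! i) - int (xs ! j)\<bar> > 1)"
    proof -
      have "(i < j \<and> j < n \<longrightarrow> \<not> (cyc_adj pos ?U i j \<and> lin_adj (val xs) ?U i j)) \<longleftrightarrow>
        (i < j \<and> j < n \<and> (j = Suc i \<or> (i = 0 \<and> j = n - 1)) \<longrightarrow> \<bar>int (xs ! i) - int (xs ! j)\<bar> > 1)" for i j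
      proof (cases "i < j \<and> j < n")
        case True
        then have "cyc_adj pos ?U i j \<longleftrightarrow> j = Suc i \<or> (i = 0 \<and> j = n - 1)"
          "lin_adj (val xs) ?U i j \<longleftrightarrow> \<not> \<bar>int (xs ! i) - int (xs ! j)\<bar> > 1"
          using cyc[of i j] lin[of i j] by auto
        then show ?thesis using True by blast
      qed blast
      then show ?thesis by simp
    qed
    also have "\<dots> \<longleftrightarrow> (\<forall>i. i + 1 < n \<longrightarrow> \<bar>int (xs ! i) - int (xs ! (i + 1))\<bar> > 1) \<and> \<bar>int (xs ! 0) - int (xs ! (n - 1))\<bar> > 1"
      using False assms by auto
    finally show ?thesis by (simp add: abs_minus_commute)
  qed
  then show ?thesis using False by (auto simp: CK_def)
qed

lemma CK_all_iff: "xs \<in> CK_all \<longleftrightarrow> xs \<in> perms (length xs) \<and> xs \<noteq> [] \<and> cyc_king pos (val xs) {..<length xs}"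
proof -
  have "xs \<in> CK_all \<longleftrightarrow> length xs \<ge> 1 \<and> xs \<in> CK (length xs)"
  proof
    assume "xs \<in> CK_all"
    then obtain n where n: "n \<ge> 1" "xs \<in> CK n" by (auto simp: CK_all_def)
    then have "length xs = n" using CK_iff_cyc_king length_perms by blast
    then show "length xs \<ge> 1 \<and> xs \<in> CK (length xs)" using n by simp
  qed (auto simp: CK_all_def)
  then show ?thesis using CK_iff_cyc_king[of "length xs" xs] by (auto simp: Suc_le_eq)
qed

theorem theorem3p6:
  fixes \<sigma> \<pi> :: "nat list"
  assumes "\<sigma> \<in> CK_all" and "\<pi> \<in> CK_all"
    and "\<pi> \<prec> \<sigma>"
    and "int (length \<sigma>) - int (length \<pi>) > 4"
  shows "\<exists>\<tau> \<in> CK_all. \<pi> \<prec> \<tau> \<and> \<tau> \<prec> \<sigma> \<and> int (length \<sigma>) - int (length \<tau>) \<le> 4"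
proof -
  let ?U = "{..<length \<sigma>}"
  have ck: "cyc_king pos (val \<sigma>) ?U" "cyc_king pos (val \<pi>) {..<length \<pi>}" and ne: "\<pi> \<noteq> []"
    and d: "distinct \<sigma>"
    using assms(1,2) by (auto simp: CK_all_iff perms_def permutations_of_set_def)
  have inj: "inj_on pos ?U" "inj_on (val \<sigma>) ?U"
    using d by (auto simp: inj_on_def pos_def val_def nth_eq_iff_index_eq)
  obtain N where iso: "order_isomorphic (nths \<sigma> N) \<pi>"
    using assms(3) by (auto simp: pattern_less_def subseq_conv_nths)
  define P where "P = N \<inter> ?U"
  have PU: "P \<subseteq> ?U" by (auto simp: P_def)
  have isoP: "order_isomorphic (nths \<sigma> P) \<pi>"
  proof -
    have "indices \<sigma> P = indices \<sigma> N" by (auto simp: indices_def P_def intro!: filter_cong)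
    then show ?thesis using iso by (simp add: nths_conv_indices)
  qed
  then have cardP: "card P = length \<pi>"
    using length_nths_subset[OF PU] by (simp add: order_isomorphic_def)
  have "cyc_king pos (val \<sigma>) P"
    using ck(2) order_isomorphic_cyc_king[OF isoP] cyc_king_nths[OF PU] by simp
  moreover have "P \<noteq> {}" using cardP ne by auto
  moreover have "5 \<le> card (?U - P)"
    using assms(4) cardP PU finite_subset[OF PU] by (simp add: card_Diff_subset)
  ultimately obtain P' T where T: "cyc_king pos (val \<sigma>) T" "T \<subset> ?U" "card (?U - T) \<le> 4" "P' \<subset> T"
    and P': "P' = P \<or> card P = 1 \<and> card P' = 1"
    using cyc_king_drop_at_most_four[OF _ inj ck(1) _ PU] by auto
  have TU: "T \<subseteq> ?U" and P'U: "P' \<subseteq> ?U" and finT: "finite T"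
    using T(2,4) by (auto intro: finite_subset)
  let ?xs = "nths \<sigma> T" and ?h = "rank (nths \<sigma> T)"
  define \<tau> where "\<tau> = map ?h ?xs"
  have len: "length \<tau> = card T" using length_nths_subset[OF TU] by (simp add: \<tau>_def)
  have iso\<tau>: "order_isomorphic \<tau> ?xs"
    unfolding \<tau>_def by (intro order_isomorphic_map rank_less_iff)
  have sub: "subseq (nths \<sigma> P') ?xs" using T(4) by (intro subseq_nths_mono) auto
  have isoP': "order_isomorphic (nths \<sigma> P') \<pi>"
    using P'
  proof
    assume "card P = 1 \<and> card P' = 1"
    then show ?thesis using length_nths_subset[OF P'U] cardP by (auto simp: order_isomorphic_def)
  qed (use isoP in simp)
  have cardP': "card P' = length \<pi>" using P' cardP by auto
  have lt: "card P' < card T" using T(4) finT by (intro psubset_card_mono)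
  have "\<tau> \<in> CK_all"
  proof -
    have "\<tau> \<in> perms (length \<tau>)" using map_rank_in_perms[of ?xs] d by (simp add: \<tau>_def distinct_nthsI)
    moreover have "\<tau> \<noteq> []" using len lt by auto
    moreover have "cyc_king pos (val \<tau>) {..<length \<tau>}"
      using T(1) order_isomorphic_cyc_king[OF iso\<tau>] cyc_king_nths[OF TU] by simp
    ultimately show ?thesis by (simp add: CK_all_iff)
  qed
  moreover have "\<pi> \<prec> \<tau>"
    unfolding pattern_less_def
  proof (intro conjI exI)
    show "length \<pi> < length \<tau>" using lt len cardP' by simp
    show "subseq (map ?h (nths \<sigma> P')) \<tau>" unfolding \<tau>_def using sub by (rule subseq_map)
    have "set (nths \<sigma> P') \<subseteq> set ?xs" using T(4) by (auto simp: set_nths)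
    then have "order_isomorphic (map ?h (nths \<sigma> P')) (nths \<sigma> P')"
      by (intro order_isomorphic_map rank_less_iff) auto
    then show "order_isomorphic (map ?h (nths \<sigma> P')) \<pi>"
      using isoP' by (auto simp: order_isomorphic_def)
  qed
  moreover have "\<tau> \<prec> \<sigma>"
    unfolding pattern_less_def
  proof (intro conjI exI)
    show "length \<tau> < length \<sigma>" using len psubset_card_mono[OF _ T(2)] by simp
    show "subseq ?xs \<sigma>" by (auto simp: subseq_conv_nths)
    show "order_isomorphic ?xs \<tau>" using iso\<tau> by (auto simp: order_isomorphic_def)
  qed
  moreover have "int (length \<sigma>) - int (length \<tau>) \<le> 4"
    using T(3) len TU finT by (simp add: card_Diff_subset)
  ultimately show ?thesis by blast
qed

end
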